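(* For $i=1,2$ let $(B_i,C_i)$ and $(X_i,A_i)$ be CW pairs and let $f_i\colon (B_i,C_i)\to (X_i,A_i)$ be a map of pairs, such that $B_1\times B_2$ is a normal space. Then, for the map of pairs $$f_1\times f_2\colon (B_1\times B_2,\ C_1\times C_2)\to (X_1\times X_2,\ A_1\times A_2),$$ one has $\operatorname{qscat}(f_1\times f_2)\le \operatorname{qscat}(f_1)+\operatorname{qscat}(f_2)$.
   Context: All maps are continuous. Quasi-strong LS category of a map: for a map of pairs $f\colon (B,C)\to (X,A)$, $\operatorname{qscat}(f)$ is the least non-negative integer $n$ such that $B$ can be covered by open sets $V_0,\dots,V_n$ such that for each $i=0,\dots,n$ there is a homotopy $H_i\colon V_i\times[0,1]\to X$ with $H_i(-,1)=f|_{V_i}$ and $H_i(V_i,0)\subseteq A$. If no such $n$ exists, $\operatorname{qscat}(f)=\infty$. *)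

theory Defs
  imports "HOL-Analysis.Analysis"
begin

section \<open>CW pairs\<close>

definition unit_disc :: "nat \<Rightarrow> (nat \<Rightarrow> real) topology" where
  "unit_disc n = subtopology (Euclidean_space n) {x. (\<Sum>i<n. (x i)\<^sup>2) \<le> 1}"

definition disc_interior :: "nat \<Rightarrow> (nat \<Rightarrow> real) set" where
  "disc_interior n = {x \<in> topspace (unit_disc n). (\<Sum>i<n. (x i)\<^sup>2) < 1}"

text \<open>For \<open>n = 0\<close> the disc is a point, equal to its interior, and the boundary is empty.\<close>

definition disc_boundary :: "nat \<Rightarrow> (nat \<Rightarrow> real) set" where
  "disc_boundary n = {x \<in> topspace (unit_disc n). (\<Sum>i<n. (x i)\<^sup>2) = 1}"

definition characteristic_map ::
    "'a topology \<Rightarrow> nat \<Rightarrow> 'a set \<Rightarrow> ((nat \<Rightarrow> real) \<Rightarrow> 'a) \<Rightarrow> bool" where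
  "characteristic_map X n e \<phi> \<longleftrightarrow>
     e \<subseteq> topspace X \<and>
     continuous_map (unit_disc n) X \<phi> \<and>
     homeomorphic_map (subtopology (unit_disc n) (disc_interior n)) (subtopology X e) \<phi>"

text \<open>
  A CW structure in Whitehead's sense on a given Hausdorff space: \<open>E\<close> is the set of open cells,
  \<open>d e\<close> is the dimension of the cell \<open>e\<close>, and the last two conjuncts are closure finiteness
  (with the attaching maps landing in cells of lower dimension) and the weak topology.
  The converse of the implication in the last conjunct holds in every space.
\<close>

definition CW_structure :: "'a topology \<Rightarrow> 'a set set \<Rightarrow> ('a set \<Rightarrow> nat) \<Rightarrow> bool" where
  "CW_structure X E d \<longleftrightarrow>
     Hausdorff_space X \<and>
     \<Union>E = topspace X \<and>
     pairwise disjnt E \<and>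
     (\<forall>e\<in>E. \<exists>\<phi>. characteristic_map X (d e) e \<phi> \<and>
        (\<exists>F. finite F \<and> F \<subseteq> {e' \<in> E. d e' < d e} \<and> \<phi> ` disc_boundary (d e) \<subseteq> \<Union>F)) \<and>
     (\<forall>S \<subseteq> topspace X. (\<forall>e\<in>E. closedin X (S \<inter> X closure_of e)) \<longrightarrow> closedin X S)"

definition CW_pair :: "'a topology \<Rightarrow> 'a set \<Rightarrow> bool" where
  "CW_pair X A \<longleftrightarrow>
     (\<exists>E d. CW_structure X E d \<and>
        (\<exists>F \<subseteq> E. A = \<Union>F \<and> (\<forall>e\<in>F. X closure_of e \<subseteq> A)))"

section \<open>Maps of pairs and the quasi-strong category\<close>

definition map_of_pairs ::
    "'b topology \<Rightarrow> 'b set \<Rightarrow> 'x topology \<Rightarrow> 'x set \<Rightarrow> ('b \<Rightarrow> 'x) \<Rightarrow> bool" where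
  "map_of_pairs B C X A f \<longleftrightarrow> continuous_map B X f \<and> f ` C \<subseteq> A"

definition qscat_cover ::
    "'b topology \<Rightarrow> 'x topology \<Rightarrow> 'x set \<Rightarrow> ('b \<Rightarrow> 'x) \<Rightarrow> nat \<Rightarrow> bool" where
  "qscat_cover B X A f n \<longleftrightarrow>
     (\<exists>V :: nat \<Rightarrow> 'b set.
        (\<forall>i\<le>n. openin B (V i)) \<and>
        (\<Union>i\<le>n. V i) = topspace B \<and>
        (\<forall>i\<le>n. \<exists>H.
           continuous_map
             (prod_topology (subtopology B (V i)) (top_of_set {0..1::real})) X H \<and>
           (\<forall>x\<in>V i. H (x, 1) = f x) \<and>
           (\<forall>x\<in>V i. H (x, 0) \<in> A)))"

text \<open>
  The argument \<open>C\<close> records that \<open>f\<close> is regarded as a map of pairs; the subspace \<open>C\<close> does not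
  enter the value.
\<close>

definition qscat ::
    "'b topology \<Rightarrow> 'b set \<Rightarrow> 'x topology \<Rightarrow> 'x set \<Rightarrow> ('b \<Rightarrow> 'x) \<Rightarrow> enat" where
  "qscat B C X A f =
     (if \<exists>n. qscat_cover B X A f n then enat (LEAST n. qscat_cover B X A f n) else \<infinity>)"

lemma map_of_pairs_map_prod:
  assumes "map_of_pairs B1 C1 X1 A1 f1" and "map_of_pairs B2 C2 X2 A2 f2"
  shows "map_of_pairs (prod_topology B1 B2) (C1 \<times> C2) (prod_topology X1 X2) (A1 \<times> A2)
           (map_prod f1 f2)"
  using assms unfolding map_of_pairs_def map_prod_def
  by (auto simp: continuous_map_prod_top)

end

theory Submission
  imports Defs
begin

text \<open>
  Let \<open>U\<^sub>0, \<dots>, U\<^sub>n\<close> be an open cover of a normal space and \<open>s\<^sub>0 \<le> \<dots> \<le> s\<^sub>n\<^sub>+\<^sub>1\<close> the partial sums of a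
  subordinate partition of unity. For a threshold \<open>0 < c < 1\<close> the open sets \<open>{s\<^sub>i < c < s\<^sub>i\<^sub>+\<^sub>1} \<subseteq> U\<^sub>i\<close>
  are pairwise disjoint, and they miss a point only if \<open>c\<close> is one of its \<open>n\<close> values
  \<open>s\<^sub>1, \<dots>, s\<^sub>n\<close>. Apply this on \<open>B\<^sub>1 \<times> B\<^sub>2\<close> to the pullbacks of covers with \<open>n + 1\<close> and \<open>m + 1\<close> members,
  with \<open>n + m + 1\<close> common thresholds: at every point at most \<open>n + m\<close> thresholds fail for
  one of the two covers, so some threshold works for both. The sets obtained from one threshold are
  disjoint, hence the product homotopies on them glue. The functions are left unnormalised, so a
  threshold appears as the multiple \<open>c s\<^sub>n\<^sub>+\<^sub>1\<close> of the total.
\<close>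

text \<open>Induction on \<open>n\<close>, with a closed \<open>S\<close> in place of the whole
  space: Urysohn's lemma treats the last open set, and the points of \<open>S\<close> it leaves
  unsettled form a closed set covered by the remaining ones.\<close>

lemma subordinate_functions_exist:
  fixes U :: "nat \<Rightarrow> 'a set"
  assumes "normal_space X" and "\<And>i. i < n \<Longrightarrow> openin X (U i)"
    and "closedin X S" and "S \<subseteq> (\<Union>i<n. U i)"
  shows "\<exists>p. (\<forall>i<n. continuous_map X euclideanreal (p i) \<and> (\<forall>x\<in>topspace X. 0 \<le> p i x) \<and>
             (\<forall>x\<in>topspace X - U i. p i x = 0)) \<and> (\<forall>x\<in>S. \<exists>i<n. 0 < p i x)"
  using assms(2-)
proof (induction n arbitrary: S)
  case 0
  then show ?case by simp
next
  case (Suc n)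
  let ?R = "S - (\<Union>i<n. U i)"
  have "closedin X ?R"
    using Suc.prems by (intro closedin_diff openin_Union) auto
  moreover have "closedin X (topspace X - U n)"
    using Suc.prems(1) by blast
  moreover have "disjnt (topspace X - U n) ?R"
    using Suc.prems(3) by (auto simp: disjnt_def lessThan_Suc)
  ultimately obtain q where q: "continuous_map X (top_of_set {0..1::real}) q"
    and q0: "q ` (topspace X - U n) \<subseteq> {0}" and q1: "q ` ?R \<subseteq> {1}"
    using Urysohn_lemma[OF \<open>normal_space X\<close>, of _ _ 0 1] by (metis zero_le_one)
  have qc: "continuous_map X euclideanreal q" and qr: "\<And>x. x \<in> topspace X \<Longrightarrow> 0 \<le> q x"
    using q by (auto simp: continuous_map_in_subtopology)
  \<comment> \<open>Cutting at 1/2 leaves a closed part of \<open>S\<close> that avoids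
    \<open>?R\<close>, where \<open>q\<close> is 1, so the first \<open>n\<close> sets cover it.
    Elsewhere on \<open>S\<close>, \<open>q\<close> itself is positive.\<close>
  have "closedin X {x \<in> topspace X. q x \<in> {..1/2}}"
    by (rule closedin_continuous_map_preimage[OF qc]) simp
  then have "closedin X (S \<inter> {x \<in> topspace X. q x \<in> {..1/2}})"
    using Suc.prems(2) by (intro closedin_Int)
  moreover have "S \<inter> {x \<in> topspace X. q x \<in> {..1/2}} \<subseteq> (\<Union>i<n. U i)"
    using q1 by force
  ultimately obtain p where
    p: "\<And>i. i < n \<Longrightarrow> continuous_map X euclideanreal (p i) \<and> (\<forall>x\<in>topspace X. 0 \<le> p i x) \<and>
             (\<forall>x\<in>topspace X - U i. p i x = 0)"
    and pos: "\<And>x. x \<in> S \<inter> {x \<in> topspace X. q x \<in> {..1/2}} \<Longrightarrow> \<exists>i<n. 0 < p i x"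
    using Suc.IH[of "S \<inter> {x \<in> topspace X. q x \<in> {..1/2}}"] Suc.prems(1)
    by (metis (lifting) less_Suc_eq)
  have "\<exists>i<Suc n. 0 < (p(n := q)) i x" if "x \<in> S" for x
  proof (cases "q x \<le> 1/2")
    case True
    then have "x \<in> S \<inter> {x \<in> topspace X. q x \<in> {..1/2}}"
      using that closedin_subset[OF Suc.prems(2)] by auto
    then obtain i where "i < n" "0 < p i x"
      using pos by blast
    then show ?thesis
      by (intro exI[of _ i]) auto
  next
    case False
    then show ?thesis
      by (intro exI[of _ n]) auto
  qed
  moreover have "\<forall>i<Suc n. continuous_map X euclideanreal ((p(n := q)) i) \<and>
      (\<forall>x\<in>topspace X. 0 \<le> (p(n := q)) i x) \<and> (\<forall>x\<in>topspace X - U i. (p(n := q)) i x = 0)"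
    using p qc qr q0 by (auto simp: less_Suc_eq)
  ultimately show ?case
    by blast
qed

text \<open>A failing level \<open>c k * s (Suc n)\<close> must equal one of \<open>s 1\<close>,
  ..., \<open>s n\<close>; since \<open>c\<close> is injective on \<open>K\<close>, at most
  \<open>n\<close> indices can fail.\<close>

lemma card_thresholds_not_separated:
  fixes s :: "nat \<Rightarrow> real"
  assumes "finite K" and inj: "inj_on c K" and c: "c ` K \<subseteq> {0<..<1}"
    and s0: "s 0 = 0" and T: "0 < s (Suc n)"
  shows "card {k \<in> K. \<not> (\<exists>i\<le>n. s i < c k * s (Suc n) \<and> c k * s (Suc n) < s (Suc i))} \<le> n"
    (is "card ?bad \<le> n")
proof -
  have "c ` ?bad \<subseteq> (\<lambda>i. s i / s (Suc n)) ` {1..n}"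
  proof
    fix y assume "y \<in> c ` ?bad"
    then obtain k where k: "k \<in> ?bad" "y = c k" by blast
    then have y: "0 < y" "y < 1" using c by auto
    \<comment> \<open>At the first index where \<open>s\<close> exceeds the level, the preceding
      value is at most the level; failure rules out strict inequality, leaving equality.\<close>
    let ?P = "\<lambda>i. y * s (Suc n) < s i"
    define l where "l = (LEAST i. ?P i)"
    have "?P (Suc n)" using y T by simp
    then have l: "?P l" "l \<le> Suc n"
      unfolding l_def by (auto intro: LeastI Least_le)
    have "l \<noteq> 0"
      using l(1) s0 y T by (metis mult_pos_pos less_asym)
    then obtain i where i: "l = Suc i" using not0_implies_Suc by blast
    then have "\<not> ?P i"
      using not_less_Least[of i ?P] by (simp add: l_def)
    moreover have "\<not> s i < y * s (Suc n)"
      using k l i by auto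
    ultimately have e: "s i = y * s (Suc n)" by simp
    then have "i \<noteq> 0" using s0 y T by (metis mult_pos_pos less_irrefl)
    then show "y \<in> (\<lambda>i. s i / s (Suc n)) ` {1..n}"
      using e T l i by (intro image_eqI[of _ _ i]) auto
  qed
  then have "card (c ` ?bad) \<le> card {1..n}"
    by (intro surj_card_le) auto
  moreover have "card (c ` ?bad) = card ?bad"
    by (intro card_image inj_on_subset[OF inj]) auto
  ultimately show ?thesis by simp
qed

text \<open>All families \<open>G k\<close> come from the same partial sums; only the level varies
  with \<open>k\<close>. A single family need not cover the space, so the last conclusion counts the
  failures at each point.\<close>

lemma disjoint_refinements:
  fixes U :: "nat \<Rightarrow> 'a set" and K :: "nat set"
  assumes "normal_space X" and U: "\<And>i. i \<le> n \<Longrightarrow> openin X (U i)"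
    and cover: "topspace X = (\<Union>i\<le>n. U i)" and "finite K"
  obtains G where "\<And>k i. i \<le> n \<Longrightarrow> openin X (G k i) \<and> G k i \<subseteq> U i"
    and "\<And>k i j. \<lbrakk>i \<le> n; j \<le> n; i \<noteq> j\<rbrakk> \<Longrightarrow> disjnt (G k i) (G k j)"
    and "\<And>x. x \<in> topspace X \<Longrightarrow> card {k \<in> K. x \<notin> (\<Union>i\<le>n. G k i)} \<le> n"
proof -
  obtain p where
    p: "\<And>i. i \<le> n \<Longrightarrow> continuous_map X euclideanreal (p i) \<and> (\<forall>x\<in>topspace X. 0 \<le> p i x) \<and>
             (\<forall>x\<in>topspace X - U i. p i x = 0)"
    and pos: "\<And>x. x \<in> topspace X \<Longrightarrow> \<exists>i\<le>n. 0 < p i x"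
    using subordinate_functions_exist[OF \<open>normal_space X\<close>, of "Suc n" U "topspace X"] U cover
    unfolding less_Suc_eq_le lessThan_Suc_atMost by (metis (lifting) closedin_topspace order_refl)
  \<comment> \<open>The sum stops before \<open>i\<close>, so \<open>s 0\<close> is 0 and
    \<open>s (Suc n)\<close> is the total.\<close>
  define s where "s i x = (\<Sum>j<i. p j x)" for i x
  have cs: "continuous_map X euclideanreal (s i)" if "i \<le> Suc n" for i
    unfolding s_def using p that by (intro continuous_map_sum) auto
  have mono: "s i x \<le> s j x" if "x \<in> topspace X" "i \<le> j" "j \<le> Suc n" for i j x
    unfolding s_def using p that by (intro sum_mono2) auto
  have T: "0 < s (Suc n) x" if x: "x \<in> topspace X" for x
  proof -
    obtain i where "i \<le> n" "0 < p i x" using pos[OF x] by blast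
    then show ?thesis
      unfolding s_def using p x by (intro sum_pos2[of _ i]) auto
  qed
  obtain N where N: "K \<subseteq> {..N}" using \<open>finite K\<close> finite_nat_iff_bounded_le by blast
  \<comment> \<open>The shifts by 1 and 2 keep all levels with \<open>k \<le> N\<close> strictly
    between 0 and 1.\<close>
  define c where "c k = (real k + 1) / (real N + 2)" for k
  define G where "G k i = {x \<in> topspace X. s i x < c k * s (Suc n) x \<and> c k * s (Suc n) x < s (Suc i) x}"
    for k i
  have "openin X (G k i)" if "i \<le> n" for k i
  proof -
    have c1: "continuous_map X euclideanreal (\<lambda>x. c k * s (Suc n) x - s i x)"
      and c2: "continuous_map X euclideanreal (\<lambda>x. s (Suc i) x - c k * s (Suc n) x)"
      using cs that by (auto intro!: continuous_map_diff continuous_map_real_mult_left)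
    have "G k i = {x \<in> topspace X. c k * s (Suc n) x - s i x \<in> {0<..}} \<inter>
                  {x \<in> topspace X. s (Suc i) x - c k * s (Suc n) x \<in> {0<..}}"
      by (auto simp: G_def)
    also have "openin X \<dots>"
      by (intro openin_Int openin_continuous_map_preimage[OF c1] openin_continuous_map_preimage[OF c2]) auto
    finally show ?thesis .
  qed
  moreover have "G k i \<subseteq> U i" if "i \<le> n" for k i
  proof
    fix x assume "x \<in> G k i"
    then have "x \<in> topspace X" "p i x \<noteq> 0" by (auto simp: G_def s_def)
    then show "x \<in> U i" using p that by blast
  qed
  moreover have "disjnt (G k i) (G k j)" if "i \<le> n" "j \<le> n" "i \<noteq> j" for k i j
  proof -
    \<comment> \<open>On \<open>G k i\<close> the level lies below \<open>s (Suc i)\<close>, on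
      \<open>G k j\<close> above \<open>s j\<close>; as \<open>Suc i \<le> j\<close>, monotonicity
      excludes a common point.\<close>
    have "disjnt (G k i) (G k j)" if "i < j" "j \<le> n" for i j
      using mono[of _ "Suc i" j] that by (force simp: disjnt_iff G_def)
    then show ?thesis
      using that by (metis disjnt_sym linorder_neqE_nat)
  qed
  moreover have "card {k \<in> K. x \<notin> (\<Union>i\<le>n. G k i)} \<le> n" if x: "x \<in> topspace X" for x
  proof -
    have "inj_on c K" by (auto simp: inj_on_def c_def)
    moreover have "c ` K \<subseteq> {0<..<1}" using N by (auto simp: c_def)
    ultimately have "card {k \<in> K. \<not> (\<exists>i\<le>n. s i x < c k * s (Suc n) x \<and> c k * s (Suc n) x < s (Suc i) x)} \<le> n"
      using T[OF x] by (intro card_thresholds_not_separated[OF \<open>finite K\<close>]) (auto simp: s_def)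
    then show ?thesis using x by (simp add: G_def atMost_def)
  qed
  ultimately show ?thesis using that[of G] by blast
qed

lemma qscat_cover_map_prod:
  assumes normal: "normal_space (prod_topology B1 B2)"
    and n: "qscat_cover B1 X1 A1 f1 n" and m: "qscat_cover B2 X2 A2 f2 m"
  shows "qscat_cover (prod_topology B1 B2) (prod_topology X1 X2) (A1 \<times> A2) (map_prod f1 f2) (n + m)"
proof -
  let ?Z = "prod_topology B1 B2" and ?I = "top_of_set {0..1::real}"
  obtain U H1 where U: "\<And>i. i \<le> n \<Longrightarrow> openin B1 (U i)" "(\<Union>i\<le>n. U i) = topspace B1"
    and H1: "\<And>i. i \<le> n \<Longrightarrow> continuous_map (prod_topology (subtopology B1 (U i)) ?I) X1 (H1 i) \<and>
           (\<forall>x\<in>U i. H1 i (x, 1) = f1 x) \<and> (\<forall>x\<in>U i. H1 i (x, 0) \<in> A1)"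
    using n unfolding qscat_cover_def by metis
  obtain V H2 where V: "\<And>j. j \<le> m \<Longrightarrow> openin B2 (V j)" "(\<Union>j\<le>m. V j) = topspace B2"
    and H2: "\<And>j. j \<le> m \<Longrightarrow> continuous_map (prod_topology (subtopology B2 (V j)) ?I) X2 (H2 j) \<and>
           (\<forall>x\<in>V j. H2 j (x, 1) = f2 x) \<and> (\<forall>x\<in>V j. H2 j (x, 0) \<in> A2)"
    using m unfolding qscat_cover_def by metis
  obtain G where G: "\<And>k i. i \<le> n \<Longrightarrow> openin ?Z (G k i) \<and> G k i \<subseteq> U i \<times> topspace B2"
    and Gd: "\<And>k i j. \<lbrakk>i \<le> n; j \<le> n; i \<noteq> j\<rbrakk> \<Longrightarrow> disjnt (G k i) (G k j)"
    and Gc: "\<And>x. x \<in> topspace ?Z \<Longrightarrow> card {k \<in> {..n+m}. x \<notin> (\<Union>i\<le>n. G k i)} \<le> n"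
  proof (rule disjoint_refinements[OF normal, of n "\<lambda>i. U i \<times> topspace B2" "{..n+m}"])
    show "topspace ?Z = (\<Union>i\<le>n. U i \<times> topspace B2)" using U(2) by auto
  qed (use U(1) in \<open>auto simp: openin_prod_Times_iff\<close>)
  obtain F where F: "\<And>k j. j \<le> m \<Longrightarrow> openin ?Z (F k j) \<and> F k j \<subseteq> topspace B1 \<times> V j"
    and Fd: "\<And>k i j. \<lbrakk>i \<le> m; j \<le> m; i \<noteq> j\<rbrakk> \<Longrightarrow> disjnt (F k i) (F k j)"
    and Fc: "\<And>x. x \<in> topspace ?Z \<Longrightarrow> card {k \<in> {..n+m}. x \<notin> (\<Union>j\<le>m. F k j)} \<le> m"
  proof (rule disjoint_refinements[OF normal, of m "\<lambda>j. topspace B1 \<times> V j" "{..n+m}"])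
    show "topspace ?Z = (\<Union>j\<le>m. topspace B1 \<times> V j)" using V(2) by auto
  qed (use V(1) in \<open>auto simp: openin_prod_Times_iff\<close>)
  \<comment> \<open>For fixed \<open>k\<close>, the set \<open>W k\<close> is the disjoint union of
    the pieces \<open>Q k (i, j)\<close>, each inside \<open>U i \<times> V j\<close>, where both
    \<open>H1 i\<close> and \<open>H2 j\<close> are available.\<close>
  define P where "P = {..n} \<times> {..m}"
  define Q where "Q k = (\<lambda>(i, j). G k i \<inter> F k j)" for k
  define W where "W k = (\<Union>ij\<in>P. Q k ij)" for k
  have Qo: "openin ?Z (Q k ij)" if "ij \<in> P" for k ij
    using that G F by (auto simp: P_def Q_def)
  have QUV: "Q k (i, j) \<subseteq> U i \<times> V j" if "(i, j) \<in> P" for k i j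
    using that G[of i k] F[of j k] by (auto simp: P_def Q_def)
  have Qd: "ij = ij'" if "ij \<in> P" "ij' \<in> P" "z \<in> Q k ij" "z \<in> Q k ij'" for k ij ij' z
    using that Gd[of "fst ij" "fst ij'" k] Fd[of "snd ij" "snd ij'" k]
    by (cases ij; cases ij') (auto simp: P_def Q_def disjnt_def)
  have Wo: "openin ?Z (W k)" for k
    unfolding W_def using Qo by blast
  have "\<exists>k\<le>n+m. z \<in> W k" if z: "z \<in> topspace ?Z" for z
  proof -
    let ?a = "{k \<in> {..n+m}. z \<notin> (\<Union>i\<le>n. G k i)}" and ?b = "{k \<in> {..n+m}. z \<notin> (\<Union>j\<le>m. F k j)}"
    have "card (?a \<union> ?b) \<le> n + m"
      using card_Un_le[of ?a ?b] Gc[OF z] Fc[OF z] by linarith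
    \<comment> \<open>There are \<open>n + m + 1\<close> thresholds, one more than can fail at
      \<open>z\<close>.\<close>
    then have "?a \<union> ?b \<noteq> {..n+m}" by auto
    then obtain k where "k \<le> n + m" "k \<notin> ?a \<union> ?b" by blast
    then show ?thesis
      by (intro exI[of _ k]) (auto simp: W_def Q_def P_def)
  qed
  then have Wc: "(\<Union>k\<le>n+m. W k) = topspace ?Z"
    using openin_subset[OF Wo] by blast
  have "\<exists>H. continuous_map (prod_topology (subtopology ?Z (W k)) ?I) (prod_topology X1 X2) H \<and>
           (\<forall>z\<in>W k. H (z, 1) = map_prod f1 f2 z) \<and> (\<forall>z\<in>W k. H (z, 0) \<in> A1 \<times> A2)" for k
  proof -
    let ?Y = "prod_topology (subtopology ?Z (W k)) ?I"
    \<comment> \<open>Both homotopies run simultaneously, with a shared time parameter.\<close>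
    define h where "h = (\<lambda>(i, j) ((x, y), t). (H1 i (x, t :: real), H2 j (y, t)))"
    have tY: "topspace ?Y = W k \<times> {0..1}"
      using openin_subset[OF Wo[of k]] by auto
    have Yo: "openin ?Y (Q k ij \<times> {0..1})" if "ij \<in> P" for ij
      using that Qo[OF that, of k]
      by (auto simp: openin_prod_Times_iff openin_subtopology W_def intro!: exI[of _ "Q k ij"])
    have hc: "continuous_map (subtopology ?Y (Q k ij \<times> {0..1})) (prod_topology X1 X2) (h ij)"
      if P: "ij \<in> P" for ij
    proof -
      obtain i j where ij: "ij = (i, j)" by force
      let ?Y' = "subtopology ?Y (Q k ij \<times> {0..1})"
      \<comment> \<open>Pasting asks for continuity on a subspace of \<open>?Y\<close>; as
        \<open>Q k ij\<close> lies in \<open>W k\<close>, that subspace is again a cylinder, over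
        \<open>Q k ij\<close>.\<close>
      have "?Y' = prod_topology (subtopology ?Z (Q k ij)) ?I"
        using P by (auto simp: subtopology_Times[symmetric] subtopology_subtopology W_def
            intro!: arg_cong2[where f = prod_topology] arg_cong2[where f = subtopology])
      then have z: "continuous_map ?Y' ?Z fst" and t: "continuous_map ?Y' ?I snd"
        and tY': "topspace ?Y' = (topspace ?Z \<inter> Q k ij) \<times> {0..1}"
        using continuous_map_fst[of "subtopology ?Z (Q k ij)" ?I]
          continuous_map_snd[of "subtopology ?Z (Q k ij)" ?I]
        by (auto simp: continuous_map_in_subtopology)
      have "continuous_map ?Y' B1 (\<lambda>w. fst (fst w))" "continuous_map ?Y' B2 (\<lambda>w. snd (fst w))"
        using continuous_map_compose[OF z continuous_map_fst]
          continuous_map_compose[OF z continuous_map_snd] by (auto simp: o_def)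
      then have "continuous_map ?Y' (prod_topology (subtopology B1 (U i)) ?I) (\<lambda>w. (fst (fst w), snd w))"
        "continuous_map ?Y' (prod_topology (subtopology B2 (V j)) ?I) (\<lambda>w. (snd (fst w), snd w))"
        using QUV[of i j k] P t tY'
        by (auto simp: continuous_map_pairwise o_def continuous_map_in_subtopology ij)
      then have "continuous_map ?Y' X1 (H1 i \<circ> (\<lambda>w. (fst (fst w), snd w)))"
        "continuous_map ?Y' X2 (H2 j \<circ> (\<lambda>w. (snd (fst w), snd w)))"
        using H1[of i] H2[of j] P by (auto simp: ij P_def intro: continuous_map_compose)
      then show ?thesis
        by (simp add: ij h_def continuous_map_pairwise o_def case_prod_unfold)
    qed
    obtain H where H: "continuous_map ?Y (prod_topology X1 X2) H"
      and Hp: "\<And>w ij. \<lbrakk>ij \<in> P; w \<in> topspace ?Y \<inter> (Q k ij \<times> {0..1})\<rbrakk> \<Longrightarrow> H w = h ij w"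
    \<comment> \<open>Compatibility holds because pieces sharing a point have the same index
      pair.\<close>
    proof (rule pasting_lemma_exists[OF _ Yo hc])
      show "topspace ?Y \<subseteq> (\<Union>ij\<in>P. Q k ij \<times> {0..1})"
        unfolding tY by (auto simp: W_def)
      show "h ij w = h ij' w"
        if "ij \<in> P" "ij' \<in> P" "w \<in> topspace ?Y \<inter> (Q k ij \<times> {0..1}) \<inter> (Q k ij' \<times> {0..1})" for ij ij' w
        using Qd[OF that(1,2), of "fst w" k] that(3) by auto
    qed blast+
    have Hh: "H (z, t) = h ij (z, t)" if "ij \<in> P" "z \<in> Q k ij" "t \<in> {0..1}" for z t ij
    proof -
      have "(z, t) \<in> topspace ?Y" unfolding tY using that by (auto simp: W_def)
      then show ?thesis using Hp[OF that(1)] that by blast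
    qed
    have "H (z, 1) = map_prod f1 f2 z \<and> H (z, 0) \<in> A1 \<times> A2" if "z \<in> W k" for z
    proof -
      obtain i j where ij: "(i, j) \<in> P" "z \<in> Q k (i, j)"
        using \<open>z \<in> W k\<close> by (auto simp: W_def)
      obtain x y where z: "z = (x, y)" by force
      have "x \<in> U i" "y \<in> V j" "i \<le> n" "j \<le> m" using QUV[OF ij(1)] ij z by (auto simp: P_def)
      then show ?thesis
        using Hh[OF ij] H1[of i] H2[of j] by (simp add: z h_def)
    qed
    then show ?thesis using H by blast
  qed
  then show ?thesis
    unfolding qscat_cover_def using Wo Wc by (intro exI[of _ W]) simp
qed

theorem proposition2p10:
  fixes B1 :: "'a topology" and B2 :: "'b topology"
    and X1 :: "'c topology" and X2 :: "'d topology"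
    and C1 :: "'a set" and C2 :: "'b set" and A1 :: "'c set" and A2 :: "'d set"
    and f1 :: "'a \<Rightarrow> 'c" and f2 :: "'b \<Rightarrow> 'd"
  assumes "CW_pair B1 C1" and "CW_pair X1 A1"
    and "CW_pair B2 C2" and "CW_pair X2 A2"
    and "map_of_pairs B1 C1 X1 A1 f1"
    and "map_of_pairs B2 C2 X2 A2 f2"
    and "normal_space (prod_topology B1 B2)"
  shows "qscat (prod_topology B1 B2) (C1 \<times> C2) (prod_topology X1 X2) (A1 \<times> A2) (map_prod f1 f2)
           \<le> qscat B1 C1 X1 A1 f1 + qscat B2 C2 X2 A2 f2"
\<comment> \<open>If either category is infinite, so is the right-hand side; otherwise covers of
  minimal length are combined.\<close>
proof (cases "(\<exists>n. qscat_cover B1 X1 A1 f1 n) \<and> (\<exists>m. qscat_cover B2 X2 A2 f2 m)")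
  case True
  let ?n = "LEAST n. qscat_cover B1 X1 A1 f1 n" and ?m = "LEAST m. qscat_cover B2 X2 A2 f2 m"
  have "qscat_cover (prod_topology B1 B2) (prod_topology X1 X2) (A1 \<times> A2) (map_prod f1 f2) (?n + ?m)"
    using True by (intro qscat_cover_map_prod assms(7)) (auto intro: LeastI)
  then show ?thesis
    using True by (auto simp: qscat_def intro: Least_le)
next
  case False
  then show ?thesis
    by (auto simp: qscat_def)
qed

end
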